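(* Let $k\geq 2$ and $n\geq 4$ be integers. If $n$ is even, then \[\mathrm{R}_k(W_n)-1\geq \max\{(\mathrm{R}_{k-\ell}(K_4^-)-1)\cdot (\mathrm{R}_{\ell}(W_n)-1)\mid 1\leq \ell\leq k-1\}.\] If $n$ is odd, then \[\mathrm{R}_k(W_n)-1\geq \max\{(\mathrm{R}_{k-\ell}(K_3)-1)\cdot (\mathrm{R}_{\ell}(W_n)-1)\mid 1\leq \ell\leq k-1\}.\]
   Context: For an integer $n\geq 4$, the wheel $W_n$ is the graph on $n$ vertices obtained from the cycle $C_{n-1}$ by adding one new vertex adjacent to every vertex of the cycle. $K_4^-$ denotes the graph obtained from the complete graph $K_4$ by deleting one edge. For a graph $G$ and a positive integer $k$, $\mathrm{R}_k(G)$ is the smallest integer $N$ such that every coloring of the edges of $K_N$ with $k$ colors contains a monochromatic copy of $G$ (so $\mathrm{R}_1(G)=|V(G)|$). *)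

theory Defs
  imports Main "HOL-Library.Ramsey"
begin

text \<open>A simple graph is a pair of a vertex set and a set of two-element subsets of it
  (\<open>nsets V 2\<close> being the set of all of these).\<close>

type_synonym 'a graph = "'a set \<times> 'a set set"

abbreviation verts :: "'a graph \<Rightarrow> 'a set" where
  "verts \<equiv> fst"

abbreviation edges :: "'a graph \<Rightarrow> 'a set set" where
  "edges \<equiv> snd"

definition simple_graph :: "'a graph \<Rightarrow> bool" where
  "simple_graph G \<longleftrightarrow> edges G \<subseteq> nsets (verts G) 2"

definition complete_graph :: "nat \<Rightarrow> nat graph" where
  "complete_graph n = ({..<n}, nsets {..<n} 2)"

text \<open>Only for \<open>m \<ge> 3\<close> is this a simple graph that is a cycle.\<close>

definition cycle_graph :: "nat \<Rightarrow> nat graph" where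
  "cycle_graph m = ({..<m}, (\<lambda>i. {i, (i + 1) mod m}) ` {..<m})"

text \<open>The cycle occupies the vertices \<open>0, \<dots>, n - 2\<close>, so \<open>n - 1\<close> is a new vertex, the hub. In total
  there are \<open>n\<close> vertices.\<close>

definition wheel :: "nat \<Rightarrow> nat graph" where
  "wheel n =
     (insert (n - 1) (verts (cycle_graph (n - 1))),
      edges (cycle_graph (n - 1)) \<union> (\<lambda>v. {v, n - 1}) ` verts (cycle_graph (n - 1)))"

definition K4_minus :: "nat graph" where
  "K4_minus = (verts (complete_graph 4), edges (complete_graph 4) - {{0, 1}})"

text \<open>Copies are subgraphs, not necessarily induced ones.\<close>

definition mono_copy :: "'a graph \<Rightarrow> 'b graph \<Rightarrow> ('b set \<Rightarrow> nat) \<Rightarrow> nat \<Rightarrow> bool" where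
  "mono_copy G H c i \<longleftrightarrow>
     (\<exists>f. inj_on f (verts G) \<and> f ` verts G \<subseteq> verts H \<and>
          (\<forall>e\<in>edges G. f ` e \<in> edges H \<and> c (f ` e) = i))"

definition arrows :: "nat \<Rightarrow> nat \<Rightarrow> 'a graph \<Rightarrow> bool" where
  "arrows N k G \<longleftrightarrow>
     (\<forall>c \<in> edges (complete_graph N) \<rightarrow> {..<k}. \<exists>i<k. mono_copy G (complete_graph N) c i)"

definition ramsey_number :: "nat \<Rightarrow> 'a graph \<Rightarrow> nat" where
  "ramsey_number k G = (LEAST N. arrows N k G)"

lemma simple_graph_complete: "simple_graph (complete_graph n)"
  by (simp add: simple_graph_def complete_graph_def)

lemma simple_graph_K4_minus: "simple_graph K4_minus"
  by (auto simp: simple_graph_def complete_graph_def K4_minus_def)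

lemma simple_graph_wheel:
  assumes "n \<ge> 4"
  shows "simple_graph (wheel n)"
proof -
  have "i \<noteq> Suc i mod (n - 1)" if "i < n - 1" for i
    using assms that by (auto simp: mod_Suc)
  moreover have "Suc i mod (n - 1) < n - 1" for i
    using assms by simp
  ultimately show ?thesis
    using assms by (auto simp: simple_graph_def wheel_def cycle_graph_def)
qed

text \<open>By Ramsey's theorem the \<open>LEAST\<close> above is attained for every finite simple graph.\<close>

lemma arrows_ramsey_number:
  assumes fin: "finite (verts G)" and G: "simple_graph G"
  shows "arrows (ramsey_number k G) k G"
proof -
  define m where "m = card (verts G)"
  obtain N :: nat where N: "partn_lst {..<N} (replicate k m) 2"
    using ramsey_full by blast
  have "arrows N k G"
    unfolding arrows_def
  proof
    fix c assume "c \<in> edges (complete_graph N) \<rightarrow> {..<k}"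
    then have "c \<in> nsets {..<N} 2 \<rightarrow> {..<length (replicate k m)}"
      by (simp add: complete_graph_def)
    then obtain i where i: "i < k" and mono: "monochromatic {..<N} m 2 c i"
      using N unfolding partn_lst_def by fastforce
    then obtain H where H: "H \<in> nsets {..<N} m" and cH: "c ` nsets H 2 \<subseteq> {i}"
      unfolding monochromatic_def by blast
    have finH: "finite H" and cardH: "card H = m" and subH: "H \<subseteq> {..<N}"
      using H by (auto simp: nsets_def)
    obtain f where f: "bij_betw f (verts G) H"
      using fin finH cardH m_def finite_same_card_bij by metis
    have inj: "inj_on f (verts G)" and im: "f ` verts G = H"
      using f by (auto simp: bij_betw_def)
    have fe: "f ` e \<in> nsets H 2" if "e \<in> edges G" for e
    proof -
      have "e \<subseteq> verts G" "finite e" "card e = 2"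
        using that G by (auto simp: simple_graph_def nsets_def)
      then show ?thesis
        using inj im by (auto simp: nsets_def card_image inj_on_subset)
    qed
    moreover have "c (f ` e) = i" if "e \<in> edges G" for e
      using fe[OF that] cH by blast
    ultimately have "mono_copy G (complete_graph N) c i"
      unfolding mono_copy_def
      using inj im subH nsets_mono[OF subH, of 2]
      by (intro exI[of _ f]) (auto simp: complete_graph_def)
    with i show "\<exists>i<k. mono_copy G (complete_graph N) c i"
      by blast
  qed
  then show ?thesis
    unfolding ramsey_number_def by (rule LeastI)
qed

end

theory Submission
  imports Defs
begin

text \<open>Let \<open>H\<close> be \<open>K4_minus\<close> or a triangle. Take a colouring of a complete graph without a
  monochromatic \<open>H\<close>, and replace every vertex by a complete graph coloured with fresh colours without
  a monochromatic wheel. A wheel in a fresh colour lies inside a single block, since its hub is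
  adjacent to everything. A wheel in an old colour is projected homomorphically to the first colouring.
  The triangles of the wheel survive this, and if the rim is an odd cycle, then its image, an
  odd closed walk, cannot alternate between two vertices. So it has three consecutive
  distinct vertices, which form a \<open>K4_minus\<close> with the image of the hub.\<close>

section \<open>Ramsey numbers as thresholds\<close>

lemma arrows_mono:
  assumes "arrows M k G" "M \<le> N"
  shows "arrows N k G"
  unfolding arrows_def
proof
  fix c assume c: "c \<in> edges (complete_graph N) \<rightarrow> {..<k}"
  have sub: "edges (complete_graph M) \<subseteq> edges (complete_graph N)"
    "verts (complete_graph M) \<subseteq> verts (complete_graph N)"
    using assms(2) by (simp_all add: complete_graph_def nsets_mono)
  then have "c \<in> edges (complete_graph M) \<rightarrow> {..<k}"
    using c by blast
  then obtain i where "i < k" "mono_copy G (complete_graph M) c i"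
    using assms(1) unfolding arrows_def by blast
  moreover from this(2) obtain f where "inj_on f (verts G)"
      "f ` verts G \<subseteq> verts (complete_graph M)"
      "\<forall>e\<in>edges G. f ` e \<in> edges (complete_graph M) \<and> c (f ` e) = i"
    unfolding mono_copy_def by metis
  with sub have "mono_copy G (complete_graph N) c i"
    unfolding mono_copy_def by (intro exI[of _ f]) auto
  ultimately show "\<exists>i<k. mono_copy G (complete_graph N) c i"
    by blast
qed

text \<open>The Ramsey number itself arrows, and by monotonicity so does everything above it.
  Exhibiting one good colouring on N vertices is therefore enough for a lower bound.\<close>

lemma not_arrows_imp_less_ramsey_number:
  assumes "finite (verts G)" "simple_graph G" "\<not> arrows N k G"
  shows "N < ramsey_number k G"
  using arrows_ramsey_number[OF assms(1,2), of k] arrows_mono assms(3) not_less by metis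

text \<open>With this, \<open>ramsey_number k G - 1\<close> on the natural numbers is a genuine
  predecessor. The number 0 fails because a graph with a vertex has no copy in
  \<open>complete_graph 0\<close>.\<close>

lemma ramsey_number_pos:
  assumes "finite (verts G)" "simple_graph G" "verts G \<noteq> {}"
  shows "0 < ramsey_number k G"
proof (rule not_arrows_imp_less_ramsey_number[OF assms(1,2)])
  have "\<not> mono_copy G (complete_graph 0) c i" for c i
    using assms(3) by (auto simp: mono_copy_def complete_graph_def)
  moreover have "(\<lambda>_. 0) \<in> edges (complete_graph 0) \<rightarrow> {..<k}"
    by (auto simp: complete_graph_def nsets_def)
  ultimately show "\<not> arrows 0 k G"
    unfolding arrows_def by blast
qed

lemma not_arrows_ramsey_number_diff:
  assumes "finite (verts G)" "simple_graph G" "verts G \<noteq> {}"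
  shows "\<not> arrows (ramsey_number k G - 1) k G"
  using ramsey_number_pos[OF assms, of k] unfolding ramsey_number_def
  by (intro not_less_Least) simp

section \<open>Homomorphisms and the product colouring\<close>

definition mono_hom :: "'a graph \<Rightarrow> 'b graph \<Rightarrow> ('b set \<Rightarrow> nat) \<Rightarrow> nat \<Rightarrow> ('a \<Rightarrow> 'b) \<Rightarrow> bool" where
  "mono_hom G H c i g \<longleftrightarrow>
     g ` verts G \<subseteq> verts H \<and> (\<forall>e\<in>edges G. g ` e \<in> edges H \<and> c (g ` e) = i)"

text \<open>Injectivity is split off because projecting a copy to the blocks may destroy it, while
  the coloured edges can still survive.\<close>

lemma mono_copy_iff_mono_hom:
  "mono_copy G H c i \<longleftrightarrow> (\<exists>f. inj_on f (verts G) \<and> mono_hom G H c i f)"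
  by (simp add: mono_copy_def mono_hom_def)

text \<open>The role of the wheel is reduced to two properties: the hub h confines a copy in a fresh
  colour to one block, and \<open>hom\<close> turns the projection of a copy in an old colour into a
  forbidden copy of H.\<close>

lemma not_arrows_product:
  fixes G :: "'a graph" and H :: "'b graph"
  assumes hub: "h \<in> verts G" "\<And>v. v \<in> verts G \<Longrightarrow> v \<noteq> h \<Longrightarrow> {v, h} \<in> edges G"
    and hom: "\<And>c i g. mono_hom G (complete_graph A) c i g \<Longrightarrow> mono_copy H (complete_graph A) c i"
    and A: "\<not> arrows A p H" and B: "\<not> arrows B q G"
  shows "\<not> arrows (A * B) (p + q) G"
proof -
  obtain a where a: "a \<in> nsets {..<A} 2 \<rightarrow> {..<p}"
    and noH: "\<And>i. i < p \<Longrightarrow> \<not> mono_copy H (complete_graph A) a i"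
    using A unfolding arrows_def by (auto simp: complete_graph_def)
  obtain b where b: "b \<in> nsets {..<B} 2 \<rightarrow> {..<q}"
    and noG: "\<And>i. i < q \<Longrightarrow> \<not> mono_copy G (complete_graph B) b i"
    using B unfolding arrows_def by (auto simp: complete_graph_def)
  \<comment> \<open>Vertex x is the vertex number \<open>\<rho> x\<close> of block number
    \<open>\<pi> x\<close>, each block having B vertices.\<close>
  define \<pi> where "\<pi> x = x div B" for x
  define \<rho> where "\<rho> x = x mod B" for x
  \<comment> \<open>An edge inside a block projects to a singleton, which is not in
    \<open>nsets {..<A} 2\<close>, so the test detects edges between blocks. The shift by p keeps
    the fresh colours apart from the old ones.\<close>
  define c where "c e = (if \<pi> ` e \<in> nsets {..<A} 2 then a (\<pi> ` e) else p + b (\<rho> ` e))" for e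
  have \<pi>: "\<pi> x < A" and \<rho>: "\<rho> x < B" if "x < A * B" for x
  proof -
    have "B > 0"
      using that by (cases "B = 0") simp_all
    then show "\<pi> x < A" "\<rho> x < B"
      using that by (simp_all add: \<pi>_def \<rho>_def less_mult_imp_div_less)
  qed
  have split: "\<pi> x * B + \<rho> x = x" for x
    by (simp add: \<pi>_def \<rho>_def)
  have eq: "x = y" if "\<pi> x = \<pi> y" "\<rho> x = \<rho> y" for x y
    by (rule trans[OF split[of x, symmetric]]) (simp only: that split)
  have block: "\<pi> x = \<pi> y" "\<rho> ` {x, y} \<in> nsets {..<B} 2"
    if "{x, y} \<in> nsets {..<A * B} 2" "\<pi> ` {x, y} \<notin> nsets {..<A} 2" for x y
  proof -
    have xy: "x < A * B" "y < A * B" "x \<noteq> y"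
      using that(1) by simp_all
    then show same: "\<pi> x = \<pi> y"
      using that(2) \<pi> by simp
    then have "\<rho> x \<noteq> \<rho> y"
      using eq xy by blast
    then show "\<rho> ` {x, y} \<in> nsets {..<B} 2"
      using \<rho> xy by simp
  qed
  have block': "\<rho> ` e \<in> nsets {..<B} 2"
    if "e \<in> nsets {..<A * B} 2" "\<pi> ` e \<notin> nsets {..<A} 2" for e
    using that(1)
    by (rule nsets2_E) (use that block(2) in blast)
  have "c \<in> nsets {..<A * B} 2 \<rightarrow> {..<p + q}"
  proof
    fix e assume "e \<in> nsets {..<A * B} 2"
    then show "c e \<in> {..<p + q}"
      using a b block'[of e] by (auto simp: c_def Pi_iff)
  qed
  moreover have "\<not> mono_copy G (complete_graph (A * B)) c i" if i: "i < p + q" for i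
  proof
    assume "mono_copy G (complete_graph (A * B)) c i"
    then obtain f where inj: "inj_on f (verts G)" and ran: "f ` verts G \<subseteq> {..<A * B}"
      and E: "\<And>e. e \<in> edges G \<Longrightarrow> f ` e \<in> nsets {..<A * B} 2"
      and C: "\<And>e. e \<in> edges G \<Longrightarrow> c (f ` e) = i"
      unfolding mono_copy_def by (auto simp: complete_graph_def)
    show False
    proof (cases "i < p")
      case True
      \<comment> \<open>A colour below p cannot be of the form \<open>p + b _\<close>, so every edge
        of this copy runs between blocks.\<close>
      have "\<pi> ` f ` e \<in> nsets {..<A} 2 \<and> a (\<pi> ` f ` e) = i" if "e \<in> edges G" for e
        using C[OF that] True by (auto simp: c_def split: if_splits)
      then have "mono_hom G (complete_graph A) a i (\<pi> \<circ> f)"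
        using ran \<pi> by (auto simp: mono_hom_def complete_graph_def image_comp)
      then show False
        using hom noH True by blast
    next
      case False
      \<comment> \<open>The values of a are below p, so a colour at least p occurs only inside
        blocks.\<close>
      have E': "\<pi> ` f ` e \<notin> nsets {..<A} 2" "b (\<rho> ` f ` e) = i - p" if "e \<in> edges G" for e
        using C[OF that] False a by (auto simp: c_def Pi_iff split: if_splits)
      have "\<pi> (f v) = \<pi> (f h)" if "v \<in> verts G" for v
      proof (cases "v = h")
        case False
        then have "{v, h} \<in> edges G"
          using hub(2) that by blast
        from E[OF this] E'(1)[OF this] show ?thesis
          by (intro block(1)) simp_all
      qed simp
      \<comment> \<open>All vertices share the block of the hub, so their positions in it already
        tell them apart.\<close>
      then have "inj_on (\<rho> \<circ> f) (verts G)"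
        using inj eq unfolding inj_on_def by (metis comp_apply)
      moreover have "mono_hom G (complete_graph B) b (i - p) (\<rho> \<circ> f)"
        using ran \<rho> E' block'[OF E] by (auto simp: mono_hom_def complete_graph_def image_comp)
      ultimately show False
        using noG[of "i - p"] i False by (auto simp: mono_copy_iff_mono_hom)
    qed
  qed
  ultimately show ?thesis
    unfolding arrows_def by (auto simp: complete_graph_def)
qed

section \<open>The product bound for wheels\<close>

lemma wheel_simps:
  assumes "n \<ge> 4"
  shows "verts (wheel n) = {..<n}"
    and "edges (wheel n) =
      (\<lambda>i. {i, Suc i mod (n - 1)}) ` {..<n - 1} \<union> (\<lambda>i. {i, n - 1}) ` {..<n - 1}"
  using assms by (auto simp: wheel_def cycle_graph_def)

lemma ramsey_number_wheel_product:
  fixes H :: "'b graph"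
  assumes n: "n \<ge> 4"
    and H: "finite (verts H)" "simple_graph H" "verts H \<noteq> {}"
    and hom: "\<And>A c i g. mono_hom (wheel n) (complete_graph A) c i g \<Longrightarrow>
      mono_copy H (complete_graph A) c i"
  shows "(int (ramsey_number p H) - 1) * (int (ramsey_number q (wheel n)) - 1)
    \<le> int (ramsey_number (p + q) (wheel n)) - 1"
proof -
  have W: "finite (verts (wheel n))" "simple_graph (wheel n)" "verts (wheel n) \<noteq> {}"
    using n by (simp_all add: wheel_simps simple_graph_wheel lessThan_empty_iff)
  have "\<not> arrows ((ramsey_number p H - 1) * (ramsey_number q (wheel n) - 1)) (p + q) (wheel n)"
  proof (rule not_arrows_product[where h = "n - 1", OF _ _ hom
        not_arrows_ramsey_number_diff[OF H] not_arrows_ramsey_number_diff[OF W]])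
    show "{v, n - 1} \<in> edges (wheel n)" if "v \<in> verts (wheel n)" "v \<noteq> n - 1" for v
      using that n by (auto simp: wheel_simps)
  qed (use n in \<open>auto simp: wheel_simps\<close>)
  then have "int ((ramsey_number p H - 1) * (ramsey_number q (wheel n) - 1))
      < int (ramsey_number (p + q) (wheel n))"
    using not_arrows_imp_less_ramsey_number[OF W(1,2)] by (simp only: of_nat_less_iff)
  \<comment> \<open>By positivity, subtraction on the natural numbers agrees with the integer
    subtraction of the claim.\<close>
  then show ?thesis
    using ramsey_number_pos[OF H, of p] ramsey_number_pos[OF W, of q] by simp
qed

section \<open>Monochromatic triangles and \<open>K4_minus\<close> in homomorphic images of
  wheels\<close>

lemma odd_closed_walk_not_alternating:
  fixes m :: nat
  assumes "odd m" and step: "\<And>i. i < m \<Longrightarrow> w i \<noteq> w (Suc i mod m)"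
  shows "\<exists>i<m. w i \<noteq> w (Suc (Suc i mod m) mod m)"
proof (rule ccontr)
  assume "\<not> ?thesis"
  then have "w (Suc (Suc i mod m) mod m) = w i" if "i < m" for i
    using that by metis
  then have alt: "w (Suc (Suc i) mod m) = w i" if "i < m" for i
    using that by (simp only: mod_Suc_eq)
  \<comment> \<open>Moving by two from 0 reaches m - 1 without wrapping around, as m is odd. But m -
    1 is followed by 0 on the cycle, so equal values there contradict \<open>step\<close>.\<close>
  have even_steps: "2 * j < m \<Longrightarrow> w (2 * j) = w 0" for j
  proof (induction j)
    case (Suc j)
    then have "w (Suc (Suc (2 * j))) = w (2 * j)" "w (2 * j) = w 0"
      using alt[of "2 * j"] by simp_all
    then show ?case
      by simp
  qed simp
  obtain r where r: "m = 2 * r + 1"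
    using \<open>odd m\<close> by (rule oddE)
  then have "w (m - 1) = w 0"
    using even_steps[of r] by simp
  then show False
    using step[of "m - 1"] r by simp
qed

lemma mono_copy_triangle:
  assumes "{x, y} \<in> edges (complete_graph A)" "{y, z} \<in> edges (complete_graph A)"
    "{x, z} \<in> edges (complete_graph A)"
    and "c {x, y} = i" "c {y, z} = i" "c {x, z} = i"
  shows "mono_copy (complete_graph 3) (complete_graph A) c i"
proof -
  have xyz: "x \<noteq> y" "y \<noteq> z" "x \<noteq> z" "x < A" "y < A" "z < A"
    using assms(1-3) by (auto simp: complete_graph_def)
  define f where "f = (!) [x, y, z]"
  have V: "{..<3} = {0, 1, 2 :: nat}"
    by auto
  have "inj_on f {..<3}" "f ` {..<3} \<subseteq> {..<A}"
    using xyz by (auto simp: V f_def)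
  moreover have "f ` e \<in> edges (complete_graph A) \<and> c (f ` e) = i" if "e \<in> nsets {..<3} 2" for e
  proof -
    from that have "e \<in> {{0, 1}, {1, 2}, {0, 2}}"
      unfolding nsets_2_eq V by auto
    then show ?thesis
      using assms by (auto simp: f_def)
  qed
  ultimately show ?thesis
    unfolding mono_copy_def by (intro exI[of _ f]) (simp add: complete_graph_def)
qed

text \<open>The vertices u and v take the places of 0 and 1, the ends of the deleted edge. No edge
  forces them apart, hence the separate assumption; the other pairs are distinct because they are
  edges.\<close>

lemma mono_copy_K4_minus:
  assumes "u \<noteq> v"
    and "\<And>e. e \<in> {{u, x}, {u, y}, {v, x}, {v, y}, {x, y}} \<Longrightarrow>
      e \<in> edges (complete_graph A) \<and> c e = i"
  shows "mono_copy K4_minus (complete_graph A) c i"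
proof -
  have "{{u, x}, {u, y}, {v, x}, {v, y}, {x, y}} \<subseteq> edges (complete_graph A)"
    using assms(2) by blast
  then have ne: "u \<noteq> x" "u \<noteq> y" "v \<noteq> x" "v \<noteq> y" "x \<noteq> y" "u < A" "v < A" "x < A" "y < A"
    by (simp_all add: complete_graph_def)
  define f where "f = (!) [u, v, x, y]"
  have V: "{..<4} = {0, 1, 2, 3 :: nat}"
    by auto
  have "inj_on f {..<4}" "f ` {..<4} \<subseteq> {..<A}"
    using ne assms(1) by (auto simp: V f_def)
  moreover have "f ` e \<in> edges (complete_graph A) \<and> c (f ` e) = i"
    if "e \<in> nsets {..<4} 2 - {{0, 1}}" for e
  proof -
    from that have "e \<in> {{0, 2}, {0, 3}, {1, 2}, {1, 3}, {2, 3}}"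
      unfolding nsets_2_eq V by auto
    then have "f ` e \<in> {{u, x}, {u, y}, {v, x}, {v, y}, {x, y}}"
      by (elim insertE emptyE) (simp_all add: f_def)
    then show ?thesis
      by (rule assms(2))
  qed
  ultimately show ?thesis
    unfolding mono_copy_def K4_minus_def by (intro exI[of _ f]) (simp add: complete_graph_def)
qed

lemma mono_hom_wheelD:
  assumes "n \<ge> 4" "mono_hom (wheel n) H c i g" "j < n - 1"
  shows "{g j, g (Suc j mod (n - 1))} \<in> edges H \<and> c {g j, g (Suc j mod (n - 1))} = i"
    and "{g j, g (n - 1)} \<in> edges H \<and> c {g j, g (n - 1)} = i"
proof -
  have "g ` {j, Suc j mod (n - 1)} \<in> edges H \<and> c (g ` {j, Suc j mod (n - 1)}) = i"
    "g ` {j, n - 1} \<in> edges H \<and> c (g ` {j, n - 1}) = i"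
    using assms unfolding mono_hom_def by (auto simp: wheel_simps simp del: image_insert)
  then show "{g j, g (Suc j mod (n - 1))} \<in> edges H \<and> c {g j, g (Suc j mod (n - 1))} = i"
    "{g j, g (n - 1)} \<in> edges H \<and> c {g j, g (n - 1)} = i"
    by (simp_all only: image_insert image_empty)
qed

lemma mono_hom_wheel_imp_triangle:
  assumes n: "n \<ge> 4" and g: "mono_hom (wheel n) (complete_graph A) c i g"
  shows "mono_copy (complete_graph 3) (complete_graph A) c i"
proof -
  \<comment> \<open>The triangle consists of the rim edge from 0 to 1 and the spokes at its
    ends.\<close>
  have "0 < n - 1" "1 < n - 1"
    using n by auto
  with mono_hom_wheelD[OF n g, of 0] mono_hom_wheelD[OF n g, of 1] show ?thesis
    by (intro mono_copy_triangle[of "g 0" "g 1" _ "g (n - 1)"]) auto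
qed

lemma mono_hom_even_wheel_imp_K4_minus:
  assumes n: "n \<ge> 4" "even n" and g: "mono_hom (wheel n) (complete_graph A) c i g"
  shows "mono_copy K4_minus (complete_graph A) c i"
proof -
  let ?m = "n - 1"
  note wheelD = mono_hom_wheelD[OF n(1) g]
  \<comment> \<open>Edges of a complete graph have two distinct ends, so the image of the rim is a
    walk that never stands still.\<close>
  have "g j \<noteq> g (Suc j mod ?m)" if "j < ?m" for j
    using wheelD(1)[OF that] by (auto simp: complete_graph_def)
  moreover have "odd ?m"
    using n by simp
  ultimately obtain j where j: "j < ?m" and ne: "g j \<noteq> g (Suc (Suc j mod ?m) mod ?m)"
    using odd_closed_walk_not_alternating[of ?m g] by blast
  have j': "Suc j mod ?m < ?m" "Suc (Suc j mod ?m) mod ?m < ?m"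
    using n by simp_all
  show ?thesis
    using wheelD[OF j] wheelD[OF j'(1)] wheelD(2)[OF j'(2)]
    \<comment> \<open>The outer two of the three consecutive rim vertices form the pair that need
      not be adjacent; the middle one and the hub are joined to both and to each other.\<close>
    by (intro mono_copy_K4_minus[OF ne, of "g (Suc j mod ?m)" "g ?m"])
      (auto simp: insert_commute)
qed

theorem theorem1p5:
  fixes k n :: nat
  assumes "k \<ge> 2" and "n \<ge> 4"
  shows "(even n \<longrightarrow>
            int (ramsey_number k (wheel n)) - 1 \<ge>
              Max {(int (ramsey_number (k - l) K4_minus) - 1) *
                   (int (ramsey_number l (wheel n)) - 1) | l. 1 \<le> l \<and> l \<le> k - 1}) \<and>
         (odd n \<longrightarrow>
            int (ramsey_number k (wheel n)) - 1 \<ge>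
              Max {(int (ramsey_number (k - l) (complete_graph 3)) - 1) *
                   (int (ramsey_number l (wheel n)) - 1) | l. 1 \<le> l \<and> l \<le> k - 1})"
proof -
  have Max_le: "Max {f l | l. 1 \<le> l \<and> l \<le> k - 1} \<le> b"
    if "\<And>l. l \<le> k \<Longrightarrow> f l \<le> b" for f :: "nat \<Rightarrow> int" and b
  proof -
    have "{f l | l. 1 \<le> l \<and> l \<le> k - 1} = f ` {1..k - 1}"
      by auto
    \<comment> \<open>The index range is nonempty because k is at least 2, so bounding the elements
      bounds \<open>Max\<close>.\<close>
    moreover have "Max (f ` {1..k - 1}) \<le> b"
      using assms(1) by (intro Max.boundedI) (auto intro!: that)
    ultimately show ?thesis
      by (simp only:)
  qed
  have "(int (ramsey_number (k - l) K4_minus) - 1) * (int (ramsey_number l (wheel n)) - 1)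
      \<le> int (ramsey_number k (wheel n)) - 1" if "even n" "l \<le> k" for l
    using ramsey_number_wheel_product[where p = "k - l" and q = l, OF assms(2) _ simple_graph_K4_minus _
        mono_hom_even_wheel_imp_K4_minus[OF assms(2) that(1)]] that(2)
    by (simp add: K4_minus_def complete_graph_def lessThan_empty_iff)
  moreover have "(int (ramsey_number (k - l) (complete_graph 3)) - 1)
      * (int (ramsey_number l (wheel n)) - 1) \<le> int (ramsey_number k (wheel n)) - 1"
    if "l \<le> k" for l
    using ramsey_number_wheel_product[where p = "k - l" and q = l, OF assms(2) _ simple_graph_complete _
        mono_hom_wheel_imp_triangle[OF assms(2)]] that
    by (simp add: complete_graph_def lessThan_empty_iff)
  ultimately show ?thesis
    by (intro conjI impI Max_le) simp_all
qed

end
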